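(* Let $X$ be an $sl(N,\mathbb{C})$-valued solution of the PSDYM3 equation $$G[X]\equiv X_{y\bar y}+X_{zz}+[X_z,X_{\bar y}]=0.$$ Then the linear operator $\hat R=D_z^{-1}\hat A_y$ is a recursion operator for PSDYM3: if $\Phi$ is a symmetry characteristic of PSDYM3, i.e. $(D_{\bar y}\hat A_y+D_z\hat A_z)\Phi=0$, then $\Phi'=\hat R\Phi$ is also a symmetry characteristic of PSDYM3, i.e. $(D_{\bar y}\hat A_y+D_z\hat A_z)\Phi'=0$. Moreover, if $\Phi$ is traceless, then so is $\Phi'=\hat R\Phi$.
   Context: The independent variables are $y,z,\bar y$ (complex, treated as three independent variables). $D_y,D_z,D_{\bar y}$ are the total derivatives, also denoted by subscripts; they commute and satisfy the Leibniz rule. $[\cdot,\cdot]$ is the matrix commutator. The covariant derivative operators act on matrix-valued functions $M$ by $$\hat A_yM=D_yM+[X_z,M],\qquad \hat A_zM=D_zM-[X_{\bar y},M].$$ A matrix-valued function $\Phi$ (possibly nonlocal in $X$) is a symmetry characteristic of PSDYM3 if $(D_{\bar y}\hat A_y+D_z\hat A_z)\Phi=0$ for solutions $X$ of $G[X]=0$. This is the linearization of $G[X]=0$ in the direction $\delta X=\alpha\Phi$. Convention on $D_z^{-1}$: it denotes formal integration in $z$, with $D_zD_z^{-1}=\mathrm{id}$. For a symmetry characteristic $\Phi$, the two equations $$D_z\Phi'=\hat A_y\Phi,\qquad D_{\bar y}\Phi'=-\hat A_z\Phi$$ are mutually consistent, and $\Phi'=\hat R\Phi$ denotes their common solution, with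 arbitrary additive terms (matrix functions of $y$ alone) ignored. *)

theory Defs
  imports "HOL-Analysis.Analysis"
begin

text \<open>
  The independent variables \<open>(y, z, ybar)\<close> are the components \<open>1, 2, 3\<close> of a point of
  \<open>complex ^ 3\<close>; a field is a function from such points to \<open>N \<times> N\<close> matrices with
  \<open>N = CARD('n)\<close>, considered on an open set \<open>U\<close>. Along a given solution the total derivatives
  are the partial derivatives, and a (possibly nonlocal) characteristic is a matrix function
  of \<open>(y, z, ybar)\<close>.
\<close>

type_synonym 'n field = "complex ^ 3 \<Rightarrow> complex ^ 'n ^ 'n"

text \<open>Holomorphy in three variables: every entry has a complex-linear Frechet derivative.\<close>

definition holo_on :: "(complex ^ 3) set \<Rightarrow> 'n::finite field \<Rightarrow> bool" where
  "holo_on U M \<longleftrightarrow>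
     (\<forall>p\<in>U. \<forall>i j. \<exists>c :: complex ^ 3.
        ((\<lambda>q. M q $ i $ j) has_derivative (\<lambda>h. \<Sum>k\<in>UNIV. c $ k * h $ k)) (at p))"

definition partial :: "3 \<Rightarrow> 'n::finite field \<Rightarrow> 'n field" where
  "partial k M p = (\<chi> i j. deriv (\<lambda>t. M (p + axis k t) $ i $ j) 0)"

abbreviation D_y :: "'n::finite field \<Rightarrow> 'n field" where "D_y \<equiv> partial 1"
abbreviation D_z :: "'n::finite field \<Rightarrow> 'n field" where "D_z \<equiv> partial 2"
abbreviation D_ybar :: "'n::finite field \<Rightarrow> 'n field" where "D_ybar \<equiv> partial 3"

definition commutator :: "complex ^ 'n ^ 'n \<Rightarrow> complex ^ 'n ^ 'n \<Rightarrow> complex ^ 'n::finite ^ 'n" where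
  "commutator A B = A ** B - B ** A"

definition cov_y :: "'n::finite field \<Rightarrow> 'n field \<Rightarrow> 'n field" where
  "cov_y X M p = D_y M p + commutator (D_z X p) (M p)"

definition cov_z :: "'n::finite field \<Rightarrow> 'n field \<Rightarrow> 'n field" where
  "cov_z X M p = D_z M p - commutator (D_ybar X p) (M p)"

definition G :: "'n::finite field \<Rightarrow> 'n field" where
  "G X p = D_ybar (D_y X) p + D_z (D_z X) p + commutator (D_z X p) (D_ybar X p)"

definition traceless_on :: "(complex ^ 3) set \<Rightarrow> 'n::finite field \<Rightarrow> bool" where
  "traceless_on U M \<longleftrightarrow> (\<forall>p\<in>U. trace (M p) = 0)"

definition psdym3_solution :: "(complex ^ 3) set \<Rightarrow> 'n::finite field \<Rightarrow> bool" where
  "psdym3_solution U X \<longleftrightarrow> holo_on U X \<and> (\<forall>p\<in>U. G X p = 0)"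

definition symmetry_characteristic ::
    "(complex ^ 3) set \<Rightarrow> 'n::finite field \<Rightarrow> 'n field \<Rightarrow> bool" where
  "symmetry_characteristic U X \<Phi> \<longleftrightarrow>
     holo_on U \<Phi> \<and> (\<forall>p\<in>U. D_ybar (cov_y X \<Phi>) p + D_z (cov_z X \<Phi>) p = 0)"

text \<open>
  The operator \<open>D_z\<^sup>-\<^sup>1 cov_y\<close> as a relation: \<open>\<Phi>'\<close> is one of the common solutions on \<open>U\<close> of the
  two defining equations. These solutions differ by matrix functions of \<open>y\<close> alone, which on
  a general \<open>U\<close> (whose slices \<open>y = const\<close> may be disconnected) has to be read locally.
\<close>

definition recursion_image ::
    "(complex ^ 3) set \<Rightarrow> 'n::finite field \<Rightarrow> 'n field \<Rightarrow> 'n field \<Rightarrow> bool" where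
  "recursion_image U X \<Phi> \<Phi>' \<longleftrightarrow>
     holo_on U \<Phi> \<and> holo_on U \<Phi>' \<and>
     (\<forall>p\<in>U. D_z \<Phi>' p = cov_y X \<Phi> p \<and> D_ybar \<Phi>' p = - cov_z X \<Phi> p)"

definition function_of_y_alone :: "(complex ^ 3) set \<Rightarrow> 'n::finite field \<Rightarrow> bool" where
  "function_of_y_alone U C \<longleftrightarrow>
     (\<forall>p\<in>U. \<exists>V c. open V \<and> p \<in> V \<and> V \<subseteq> U \<and> (\<forall>q\<in>V. C q = c (q $ 1)))"

definition lincomb ::
    "complex \<Rightarrow> 'n::finite field \<Rightarrow> complex \<Rightarrow> 'n field \<Rightarrow> 'n field" where
  "lincomb a M b M' p = (\<chi> i j. a * M p $ i $ j + b * M' p $ i $ j)"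

end

theory Submission
  imports Defs "HOL-Complex_Analysis.Cauchy_Integral_Formula"
begin

text \<open>
  The operators \<open>cov_z\<close> and \<open>cov_y\<close> are the covariant derivatives of a connection whose curvature
  is \<open>ad (G[X])\<close>, so they commute on solutions. The symmetry condition for \<open>\<Phi>\<close> is exactly the
  integrability condition for the two equations that define \<open>\<Phi>'\<close>, which the Poincare lemma then
  solves on balls. Substituting these two equations into the symmetry condition for
  \<open>\<Phi>'\<close> and exchanging mixed partials leaves the commutator of \<open>cov_z\<close> and \<open>cov_y\<close> applied to \<open>\<Phi>\<close>.
  Since commutators are traceless, the trace of \<open>\<Phi>'\<close> has vanishing \<open>z\<close> and \<open>ybar\<close> derivatives when
  \<open>\<Phi>\<close> is traceless, so \<open>trace \<Phi>' / N\<close> times the identity may be subtracted from \<open>\<Phi>'\<close>.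

  Holomorphy is only assumed as pointwise complex differentiability; that partial derivatives are
  again holomorphic and that mixed ones commute comes from Cauchy's integral formula.
\<close>

subsection \<open>Holomorphic functions of several variables\<close>

text \<open>Scalar counterpart of \<open>holo_on\<close>, in any finite number of variables. The
  analysis is done for scalar functions and carried over to matrices entry by entry through
  \<open>holo_on_iff\<close>.\<close>

definition hol_on :: "(complex ^ 'm::finite) set \<Rightarrow> (complex ^ 'm \<Rightarrow> complex) \<Rightarrow> bool" where
  "hol_on U f \<longleftrightarrow>
     (\<forall>p\<in>U. \<exists>c :: complex ^ 'm. (f has_derivative (\<lambda>h. \<Sum>k\<in>UNIV. c $ k * h $ k)) (at p))"

definition pdiff :: "'m::finite \<Rightarrow> (complex ^ 'm \<Rightarrow> complex) \<Rightarrow> complex ^ 'm \<Rightarrow> complex" where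
  "pdiff k f p = deriv (\<lambda>t. f (p + axis k t)) 0"

lemma hol_onI:
  assumes "\<And>p. p \<in> U \<Longrightarrow> (f has_derivative (\<lambda>h. \<Sum>k\<in>UNIV. c k p * h $ k)) (at p)"
  shows "hol_on U f"
  unfolding hol_on_def
proof
  fix p assume "p \<in> U"
  from assms[OF this] show "\<exists>c :: complex ^ 'a. (f has_derivative (\<lambda>h. \<Sum>k\<in>UNIV. c $ k * h $ k)) (at p)"
    by (intro exI[of _ "\<chi> k. c k p"]) simp
qed

lemma linear_axis: "linear (axis k :: complex \<Rightarrow> complex ^ 'm::finite)"
  by (rule linearI) (auto simp: axis_def vec_eq_iff)

lemma axis_zero: "axis k 0 = (0 :: complex ^ 'm::finite)"
  by simp

lemma norm_axis: "norm (axis k w :: complex ^ 'm::finite) = norm w"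
  by (simp add: norm_eq_sqrt_inner inner_axis_axis)

text \<open>Chain rule along a coordinate line. The parameter \<open>w\<close> is arbitrary, since
  Cauchy's formula needs differentiability on a whole disc and not only at its centre.\<close>

lemma has_derivative_imp_line:
  fixes c :: "'m::finite \<Rightarrow> complex"
  assumes "(f has_derivative (\<lambda>h. \<Sum>k\<in>UNIV. c k * h $ k)) (at (p + axis k w))"
  shows "((\<lambda>t. f (p + axis k t)) has_field_derivative c k) (at w)"
proof -
  have "((\<lambda>t. p + axis k t) has_derivative axis k) (at w)"
    using linear_axis linear_conv_bounded_linear
    by (auto intro!: derivative_eq_intros bounded_linear_imp_has_derivative)
  from has_derivative_compose[OF this assms]
  have "((\<lambda>t. f (p + axis k t)) has_derivative (\<lambda>h. \<Sum>j\<in>UNIV. c j * axis k h $ j)) (at w)" .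
  also have "(\<lambda>h. \<Sum>j\<in>UNIV. c j * axis k h $ j) = (*) (c k)"
    by (auto simp: axis_def if_distrib fun_eq_iff cong: if_cong)
  finally show ?thesis by (simp add: has_field_derivative_def)
qed

lemma pdiff_eqI:
  assumes "(f has_derivative (\<lambda>h. \<Sum>k\<in>UNIV. c k * h $ k)) (at p)"
  shows "pdiff k f p = c k"
  unfolding pdiff_def
  by (rule DERIV_imp_deriv, rule has_derivative_imp_line) (use assms in \<open>simp add: axis_zero\<close>)

lemma hol_onD:
  assumes "hol_on U f" "p \<in> U"
  shows "(f has_derivative (\<lambda>h. \<Sum>k\<in>UNIV. pdiff k f p * h $ k)) (at p)"
proof -
  obtain c :: "complex ^ 'a" where c: "(f has_derivative (\<lambda>h. \<Sum>k\<in>UNIV. c $ k * h $ k)) (at p)"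
    using assms by (auto simp: hol_on_def)
  show ?thesis using c by (simp add: pdiff_eqI[OF c])
qed

lemma hol_on_subset: "hol_on U f \<Longrightarrow> V \<subseteq> U \<Longrightarrow> hol_on V f"
  by (auto simp: hol_on_def)

lemma hol_on_imp_continuous_on: "hol_on U f \<Longrightarrow> continuous_on U f"
  by (meson hol_onD continuous_at_imp_continuous_on has_derivative_continuous)

lemma has_field_derivative_line:
  assumes "hol_on U f" "p + axis k w \<in> U"
  shows "((\<lambda>t. f (p + axis k t)) has_field_derivative pdiff k f (p + axis k w)) (at w)"
  by (rule has_derivative_imp_line) (rule hol_onD[OF assms])

text \<open>Cauchy's formula for the first derivative. The circle is centred at 0, so its velocity
  is \<open>2 * pi * \<i>\<close> times the path itself: this cancels the constant in the formula
  and one of the two factors in the denominator. What remains is an integral over a fixed real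
  interval with \<open>q\<close> as parameter.\<close>

lemma pdiff_cauchy_integral:
  assumes "hol_on U f" "r > 0" and sub: "\<And>w. norm w \<le> r \<Longrightarrow> q + axis k w \<in> U"
  shows "pdiff k f q =
    integral {0..1} (\<lambda>t. f (q + axis k (circlepath 0 r t)) / circlepath 0 r t)"
proof -
  let ?g = "\<lambda>w. f (q + axis k w)"
  have d: "(?g has_field_derivative pdiff k f (q + axis k w)) (at w)" if "norm w \<le> r" for w
    by (rule has_field_derivative_line[OF assms(1) sub[OF that]])
  have "continuous_on (cball 0 r) ?g"
    using DERIV_isCont[OF d] by (simp add: continuous_at_imp_continuous_on)
  moreover have "?g holomorphic_on ball 0 r"
    unfolding holomorphic_on_def field_differentiable_def
    by (intro ballI exI) (rule has_field_derivative_at_within[OF d], simp)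
  ultimately have "contour_integral (circlepath 0 r) (\<lambda>u. ?g u / (u - 0)^2) = (2 * pi * \<i>) * deriv ?g 0"
    by (rule Cauchy_contour_integral_circlepath_2) (use \<open>r > 0\<close> in auto)
  also have "contour_integral (circlepath 0 r) (\<lambda>u. ?g u / (u - 0)^2)
     = integral {0..1} (\<lambda>t. (2 * pi * \<i>) * (?g (circlepath 0 r t) / circlepath 0 r t))"
    unfolding contour_integral_integral
  proof (rule integral_cong)
    fix t :: real
    have "vector_derivative (circlepath 0 r) (at t) = 2 * pi * \<i> * circlepath 0 r t"
      by (rule vector_derivative_at[OF has_vector_derivative_eq_rhs[OF has_vector_derivative_circlepath]])
        (simp add: circlepath)
    moreover have "circlepath 0 r t \<noteq> 0"
      using \<open>r > 0\<close> by (simp add: circlepath)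
    ultimately show "?g (circlepath 0 r t) / (circlepath 0 r t - 0)\<^sup>2 * vector_derivative (circlepath 0 r) (at t)
        = (2 * pi * \<i>) * (?g (circlepath 0 r t) / circlepath 0 r t)"
      by (simp add: power2_eq_square field_simps)
  qed
  also have "\<dots> = (2 * pi * \<i>) * integral {0..1} (\<lambda>t. ?g (circlepath 0 r t) / circlepath 0 r t)"
    by (rule integral_mult_right)
  finally show ?thesis by (simp add: pdiff_def)
qed

text \<open>Differentiation under the integral sign in gradient form. It serves twice: for Cauchy
  integrals and for the line integral in \<open>poincare_23\<close>.\<close>

lemma integral_has_gradient:
  fixes F :: "complex ^ 'm::finite \<Rightarrow> real \<Rightarrow> complex"
  assumes V: "open V" "convex V" "p \<in> V"
    and F: "\<And>q t. q \<in> V \<Longrightarrow> t \<in> {0..1} \<Longrightarrow>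
      ((\<lambda>q. F q t) has_derivative (\<lambda>h. \<Sum>k\<in>UNIV. c k q t * h $ k)) (at q)"
    and contc: "\<And>k. continuous_on (V \<times> {0..1}) (\<lambda>(q, t). c k q t)"
    and contF: "\<And>q. q \<in> V \<Longrightarrow> continuous_on {0..1} (F q)"
  shows "((\<lambda>q. integral {0..1} (F q)) has_derivative
    (\<lambda>h. \<Sum>k\<in>UNIV. integral {0..1} (c k p) * h $ k)) (at p)"
proof -
  \<comment> \<open>\<open>leibniz_rule\<close> expects the derivative as a bounded linear map
    depending continuously on the parameters; in finite dimension this can be checked on
    coefficients.\<close>
  define D where "D q t = Blinfun (\<lambda>h :: complex ^ 'm. \<Sum>k\<in>UNIV. c k q t * h $ k)" for q t
  have D: "blinfun_apply (D q t) = (\<lambda>h. \<Sum>k\<in>UNIV. c k q t * h $ k)" for q t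
    unfolding D_def
    by (intro bounded_linear_Blinfun_apply bounded_linear_sum bounded_linear_const_mult
        bounded_linear_vec_nth)
  have contc': "continuous_on {0..1} (c k p)" for k
    using continuous_on_compose2[OF contc[of k], of "{0..1}" "Pair p"] \<open>p \<in> V\<close>
    by (force intro: continuous_on_Pair continuous_on_const continuous_on_id)
  have contD: "continuous_on (V \<times> {0..1}) (\<lambda>(q, t). D q t)"
    using contc by (intro continuous_on_blinfun_componentwise)
      (auto simp: D split_beta intro!: continuous_intros)
  have contD': "continuous_on {0..1} (D p)"
    using continuous_on_compose2[OF contD, of "{0..1}" "Pair p"] \<open>p \<in> V\<close>
    by (force intro: continuous_on_Pair continuous_on_const continuous_on_id)
  have "((\<lambda>q. integral (cbox 0 1) (F q)) has_derivative integral (cbox 0 1) (D p)) (at p within V)"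
    by (rule leibniz_rule)
       (use F V contF contD in \<open>auto simp: D intro: has_derivative_at_withinI integrable_continuous_interval\<close>)
  moreover have "blinfun_apply (integral {0..1} (D p)) h
      = (\<Sum>k\<in>UNIV. integral {0..1} (c k p) * h $ k)" for h
  proof -
    have "blinfun_apply (integral {0..1} (D p)) h = integral {0..1} (\<lambda>t. blinfun_apply (D p t) h)"
      using integral_linear[OF integrable_continuous_interval[OF contD'] bounded_linear_apply_blinfun]
      by (simp add: o_def)
    also have "\<dots> = (\<Sum>k\<in>UNIV. integral {0..1} (\<lambda>t. c k p t * h $ k))"
      unfolding D by (rule integral_sum)
        (auto intro!: integrable_continuous_interval continuous_intros contc')
    finally show ?thesis by simp
  qed
  then have "blinfun_apply (integral {0..1} (D p))
      = (\<lambda>h. \<Sum>k\<in>UNIV. integral {0..1} (c k p) * h $ k)"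
    by blast
  ultimately show ?thesis
    using V by (simp add: at_within_open[of p V])
qed

lemma continuous_on_circlepath: "continuous_on S (circlepath z r)"
  by (auto simp: circlepath_def part_circlepath_def linepath_def intro!: continuous_intros)

text \<open>Cauchy's formula in direction \<open>k\<close> first makes \<open>pdiff k f\<close> continuous; this is what permits
  differentiating the same integral under the integral sign, and reading Cauchy's formula for
  \<open>pdiff j f\<close> backwards in the result gives the symmetry of the mixed derivatives.\<close>

lemma
  fixes f :: "complex ^ 'm::finite \<Rightarrow> complex"
  assumes "open U" "hol_on U f"
  shows continuous_on_pdiff: "continuous_on U (pdiff k f)"
    and hol_on_pdiff: "hol_on U (pdiff k f)"
    and pdiff_commute: "p \<in> U \<Longrightarrow> pdiff j (pdiff k f) p = pdiff k (pdiff j f) p"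
proof -
  have "\<exists>r>0. \<forall>q\<in>ball p r. \<forall>k w. norm w \<le> r \<longrightarrow> q + axis k w \<in> U" if p: "p \<in> U" for p
  proof -
    obtain e where e: "e > 0" "ball p e \<subseteq> U"
      by (rule openE[OF \<open>open U\<close> p])
    have "q + axis k w \<in> ball p e" if "q \<in> ball p (e / 2)" "norm w \<le> e / 2" for q k w
    proof -
      have "norm (p - (q + axis k w)) \<le> norm (p - q) + norm (axis k w)"
        using norm_triangle_ineq4[of "p - q" "axis k w"] by (simp add: algebra_simps)
      then show ?thesis using that by (simp add: dist_norm norm_axis)
    qed
    with e have "\<forall>q\<in>ball p (e / 2). \<forall>k. \<forall>w. norm w \<le> e / 2 \<longrightarrow> q + axis k w \<in> U"
      by blast
    with \<open>e > 0\<close> show ?thesis by (intro exI[of _ "e / 2"]) simp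
  qed
  \<comment> \<open>Half the radius of a ball inside \<open>U\<close> leaves room both for moving
    the base point and for the circle around it. One circle thus serves every \<open>q\<close> near
    \<open>p\<close> and every direction, and the Cauchy integrand depends on \<open>q\<close> only
    through the function integrated.\<close>
  then have "\<exists>r. \<forall>p\<in>U. r p > 0 \<and> (\<forall>q\<in>ball p (r p). \<forall>k w. norm w \<le> r p \<longrightarrow> q + axis k w \<in> U)"
    by (intro bchoice) simp
  then obtain r where r: "\<And>p. p \<in> U \<Longrightarrow> r p > 0"
    and rU: "\<And>p q k w. p \<in> U \<Longrightarrow> q \<in> ball p (r p) \<Longrightarrow> norm w \<le> r p \<Longrightarrow> q + axis k w \<in> U"
    by blast
  define \<gamma> where "\<gamma> p = circlepath 0 (r p)" for p
  have \<gamma>: "norm (\<gamma> p t) = r p" "\<gamma> p t \<noteq> 0" if "p \<in> U" for p t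
    using r[OF that] by (auto simp: \<gamma>_def circlepath norm_mult)
  have cont: "continuous_on (ball p (r p) \<times> {0..1}) (\<lambda>(q, t). g (q + axis k (\<gamma> p t)) / \<gamma> p t)"
    if g: "continuous_on U g" and p: "p \<in> U" for g k p
  proof -
    have ax: "continuous_on S (axis k :: complex \<Rightarrow> complex ^ 'm)" for S
      using linear_axis linear_conv_bounded_linear linear_continuous_on by blast
    have c\<gamma>: "continuous_on S (\<gamma> p)" for S
      unfolding \<gamma>_def by (rule continuous_on_circlepath)
    show ?thesis unfolding split_beta
      using \<gamma>[OF p] rU[OF p]
      by (intro continuous_intros continuous_on_compose2[OF g] continuous_on_compose2[OF ax]
          continuous_on_compose2[OF c\<gamma>]) auto
  qed
  have cont1: "continuous_on {0..1} (\<lambda>t. g (q + axis k (\<gamma> p t)) / \<gamma> p t)"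
    if "continuous_on U g" "p \<in> U" "q \<in> ball p (r p)" for g k p q
    using continuous_on_compose2[OF cont[OF that(1,2)], of "{0..1}" "Pair q"] that(3)
    by (force intro: continuous_on_Pair continuous_on_const continuous_on_id)
  have cauchy: "pdiff k g q = integral {0..1} (\<lambda>t. g (q + axis k (\<gamma> p t)) / \<gamma> p t)"
    if "hol_on U g" "p \<in> U" "q \<in> ball p (r p)" for g k p q
    unfolding \<gamma>_def by (rule pdiff_cauchy_integral[OF that(1) r[OF that(2)] rU[OF that(2,3)]])
  have cpd: "continuous_on U (pdiff k f)" for k
  proof (rule continuous_at_imp_continuous_on, rule)
    fix p assume p: "p \<in> U"
    have "continuous_on (ball p (r p)) (\<lambda>q. integral (cbox 0 1) (\<lambda>t. f (q + axis k (\<gamma> p t)) / \<gamma> p t))"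
      by (rule integral_continuous_on_param)
        (use cont[OF hol_on_imp_continuous_on[OF assms(2)] p] in simp)
    then have "continuous_on (ball p (r p)) (pdiff k f)"
      by (rule continuous_on_eq) (use cauchy[OF assms(2) p] in simp)
    then show "isCont (pdiff k f) p"
      using r[OF p] by (simp add: continuous_on_eq_continuous_at)
  qed
  then show "continuous_on U (pdiff k f)" .
  \<comment> \<open>The coefficient in direction \<open>j\<close> has the shape of Cauchy's formula
    in direction \<open>k\<close> for \<open>pdiff j f\<close>.\<close>
  have der: "(pdiff k f has_derivative
      (\<lambda>h. \<Sum>j\<in>UNIV. integral {0..1} (\<lambda>t. pdiff j f (p + axis k (\<gamma> p t)) / \<gamma> p t) * h $ j)) (at p)"
    if p: "p \<in> U" for p k
  proof -
    let ?V = "ball p (r p)"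
    have "((\<lambda>q. integral {0..1} (\<lambda>t. f (q + axis k (\<gamma> p t)) / \<gamma> p t)) has_derivative
      (\<lambda>h. \<Sum>j\<in>UNIV. integral {0..1} (\<lambda>t. pdiff j f (p + axis k (\<gamma> p t)) / \<gamma> p t) * h $ j)) (at p)"
    proof (rule integral_has_gradient[where V = ?V
          and F = "\<lambda>q t. f (q + axis k (\<gamma> p t)) / \<gamma> p t"
          and c = "\<lambda>j q t. pdiff j f (q + axis k (\<gamma> p t)) / \<gamma> p t"])
      fix q t assume q: "q \<in> ?V" and "t \<in> {0..1::real}"
      have "((\<lambda>q. q + axis k (\<gamma> p t)) has_derivative (\<lambda>h. h)) (at q)"
        by (auto intro!: derivative_eq_intros)
      from has_derivative_compose[OF this hol_onD[OF assms(2) rU[OF p q]]] \<gamma>(1)[OF p]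
      have "((\<lambda>q. f (q + axis k (\<gamma> p t))) has_derivative
          (\<lambda>h. \<Sum>j\<in>UNIV. pdiff j f (q + axis k (\<gamma> p t)) * h $ j)) (at q)"
        by simp
      from has_derivative_mult_right[OF this, of "inverse (\<gamma> p t)"]
      show "((\<lambda>q. f (q + axis k (\<gamma> p t)) / \<gamma> p t) has_derivative
          (\<lambda>h. \<Sum>j\<in>UNIV. pdiff j f (q + axis k (\<gamma> p t)) / \<gamma> p t * h $ j)) (at q)"
        by (simp add: sum_distrib_left field_simps)
    qed (use r[OF p] cont[OF cpd p] cont1[OF hol_on_imp_continuous_on[OF assms(2)] p] in \<open>simp_all add: split_beta\<close>)
    then show ?thesis
      by (rule has_derivative_transform_within_open[of _ _ _ _ ?V])
         (use cauchy[OF assms(2) p] r[OF p] in auto)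
  qed
  have hol: "hol_on U (pdiff k f)" for k
    by (rule hol_onI) (rule der)
  then show "hol_on U (pdiff k f)" .
  show "pdiff j (pdiff k f) p = pdiff k (pdiff j f) p" if p: "p \<in> U"
    using pdiff_eqI[OF der[OF p]] cauchy[OF hol p] r[OF p] by simp
qed

section \<open>Closure properties and differentiation rules for scalar functions\<close>

lemma pdiff_line:
  assumes "hol_on U f" "p \<in> U"
  shows "((\<lambda>t. f (p + axis k t)) has_field_derivative pdiff k f p) (at 0)"
  using has_field_derivative_line[OF assms(1), of p k 0] assms(2) by (simp add: axis_zero)

lemma hol_on_const: "hol_on U (\<lambda>q. c)"
  by (rule hol_onI[where c = "\<lambda>k p. 0"]) simp

lemma hol_on_add:
  assumes "hol_on U f" "hol_on U g"
  shows "hol_on U (\<lambda>q. f q + g q)"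
proof (rule hol_onI)
  fix p assume "p \<in> U"
  then show "((\<lambda>q. f q + g q) has_derivative (\<lambda>h. \<Sum>k\<in>UNIV. (pdiff k f p + pdiff k g p) * h $ k)) (at p)"
    using has_derivative_add[OF hol_onD[OF assms(1)] hol_onD[OF assms(2)]]
    by (simp add: sum.distrib distrib_right)
qed

lemma hol_on_mult:
  assumes "hol_on U f" "hol_on U g"
  shows "hol_on U (\<lambda>q. f q * g q)"
proof (rule hol_onI)
  fix p assume "p \<in> U"
  then show "((\<lambda>q. f q * g q) has_derivative
      (\<lambda>h. \<Sum>k\<in>UNIV. (f p * pdiff k g p + pdiff k f p * g p) * h $ k)) (at p)"
    by (intro has_derivative_eq_rhs[OF has_derivative_mult[OF hol_onD[OF assms(1)] hol_onD[OF assms(2)]]])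
      (simp_all add: sum.distrib sum_distrib_left algebra_simps)
qed

lemma hol_on_cmult: "hol_on U f \<Longrightarrow> hol_on U (\<lambda>q. c * f q)"
  by (rule hol_on_mult[OF hol_on_const])

lemma hol_on_minus: "hol_on U f \<Longrightarrow> hol_on U (\<lambda>q. - f q)"
  using hol_on_cmult[of U f "-1"] by simp

lemma hol_on_diff: "hol_on U f \<Longrightarrow> hol_on U g \<Longrightarrow> hol_on U (\<lambda>q. f q - g q)"
  using hol_on_add[of U f "\<lambda>q. - g q"] hol_on_minus[of U g] by simp

lemma hol_on_sum: "(\<And>i. i \<in> I \<Longrightarrow> hol_on U (f i)) \<Longrightarrow> hol_on U (\<lambda>q. \<Sum>i\<in>I. f i q)"
  by (induction I rule: infinite_finite_induct) (auto intro: hol_on_const hol_on_add)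

lemma
  assumes "hol_on U f" "hol_on U g" "p \<in> U"
  shows pdiff_add: "pdiff k (\<lambda>q. f q + g q) p = pdiff k f p + pdiff k g p"
    and pdiff_diff: "pdiff k (\<lambda>q. f q - g q) p = pdiff k f p - pdiff k g p"
    and pdiff_mult: "pdiff k (\<lambda>q. f q * g q) p = pdiff k f p * g p + f p * pdiff k g p"
  using DERIV_imp_deriv[OF DERIV_add[OF assms(1,2)[THEN pdiff_line, OF assms(3)]]]
    DERIV_imp_deriv[OF DERIV_diff[OF assms(1,2)[THEN pdiff_line, OF assms(3)]]]
    DERIV_imp_deriv[OF DERIV_mult[OF assms(1,2)[THEN pdiff_line, OF assms(3)]]]
  by (simp_all add: pdiff_def axis_zero)

lemma pdiff_const: "pdiff k (\<lambda>q. c) p = 0"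
  by (simp add: pdiff_def)

lemma pdiff_cmult:
  assumes "hol_on U f" "p \<in> U"
  shows "pdiff k (\<lambda>q. c * f q) p = c * pdiff k f p"
  using pdiff_mult[OF hol_on_const assms] by (simp add: pdiff_const)

lemma pdiff_minus:
  assumes "hol_on U f" "p \<in> U"
  shows "pdiff k (\<lambda>q. - f q) p = - pdiff k f p"
  using pdiff_cmult[OF assms, of _ "-1"] by simp

lemma pdiff_sum:
  assumes "\<And>i. i \<in> I \<Longrightarrow> hol_on U (f i)" "p \<in> U"
  shows "pdiff k (\<lambda>q. \<Sum>i\<in>I. f i q) p = (\<Sum>i\<in>I. pdiff k (f i) p)"
  using assms(1)
proof (induction I rule: infinite_finite_induct)
  case (insert i I)
  have "pdiff k (\<lambda>q. f i q + (\<Sum>i\<in>I. f i q)) p = pdiff k (f i) p + pdiff k (\<lambda>q. \<Sum>i\<in>I. f i q) p"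
    using insert.prems by (intro pdiff_add[OF _ hol_on_sum \<open>p \<in> U\<close>]) auto
  with insert show ?case by simp
qed (simp_all add: pdiff_const)

text \<open>Allows an identity that holds throughout \<open>U\<close> to be differentiated; openness
  supplies the neighbourhood of \<open>p\<close> on which both functions agree.\<close>

lemma pdiff_cong:
  assumes "open U" "p \<in> U" "hol_on U f" "\<And>q. q \<in> U \<Longrightarrow> f q = g q"
  shows "pdiff k f p = pdiff k g p"
proof -
  have "(g has_derivative (\<lambda>h. \<Sum>k\<in>UNIV. pdiff k f p * h $ k)) (at p)"
    using hol_onD[OF assms(3,2)] assms(1,2,4) by (rule has_derivative_transform_within_open)
  from pdiff_eqI[OF this] show ?thesis by simp
qed

subsection \<open>Integration in the second and third variable\<close>

text \<open>\<open>scale23 p s q\<close> is the point at parameter \<open>s\<close> of the segment that joins \<open>q\<close> (at \<open>s = 1\<close>)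
  to the plane through \<open>p\<close> on which the second and third coordinates are constant,
  with the first coordinate held fixed.\<close>

definition scale23 :: "complex ^ 3 \<Rightarrow> real \<Rightarrow> complex ^ 3 \<Rightarrow> complex ^ 3" where
  "scale23 p s q = (\<chi> k. if k = 1 then q $ k else p $ k + s * (q $ k - p $ k))"

lemma scale23_1: "scale23 p 1 q = q"
  by (simp add: scale23_def vec_eq_iff)

text \<open>No component of the displacement from \<open>p\<close> grows: the first is kept, and the
  other two shrink by the factor \<open>s\<close>.\<close>

lemma scale23_in_ball:
  assumes "q \<in> ball p e" "s \<in> {0..1}"
  shows "scale23 p s q \<in> ball p e"
proof -
  have "norm (scale23 p s q - p) \<le> norm (q - p)"
  proof (rule norm_le_componentwise_cart)
    fix i :: 3
    have "s * cmod (q $ i - p $ i) \<le> 1 * cmod (q $ i - p $ i)"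
      using assms(2) by (intro mult_right_mono) auto
    then show "norm ((scale23 p s q - p) $ i) \<le> norm ((q - p) $ i)"
      using assms(2) by (simp add: scale23_def norm_mult)
  qed
  with assms(1) show ?thesis by (simp add: dist_norm norm_minus_commute)
qed

lemma continuous_on_scale23:
  fixes S :: "((complex ^ 3) \<times> real) set"
  shows "continuous_on S (\<lambda>x. scale23 p (snd x) (fst x))"
  unfolding scale23_def
proof (rule continuous_on_vec_lambda)
  fix k :: 3
  show "continuous_on S (\<lambda>x. if k = 1 then fst x $ k else p $ k + complex_of_real (snd x) * (fst x $ k - p $ k))"
    by (cases "k = 1") (auto intro!: continuous_intros)
qed

lemma has_derivative_vec_lambda:
  fixes f :: "'a::real_normed_vector \<Rightarrow> 'm::finite \<Rightarrow> 'b::euclidean_space"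
  assumes "\<And>k. ((\<lambda>x. f x k) has_derivative (\<lambda>h. f' h k)) (at x within S)"
  shows "((\<lambda>x. \<chi> k. f x k) has_derivative (\<lambda>h. \<chi> k. f' h k)) (at x within S)"
  using assms by (intro has_derivative_componentwise_within[THEN iffD2])
   (auto simp: Basis_vec_def inner_axis intro!: derivative_intros)

lemma has_derivative_compose_scale23:
  assumes "hol_on V f" "scale23 p s q \<in> V"
  shows "((\<lambda>q. f (scale23 p s q)) has_derivative
    (\<lambda>h. \<Sum>k\<in>UNIV. (if k = 1 then 1 else of_real s) * pdiff k f (scale23 p s q) * h $ k)) (at q)"
proof -
  have "(scale23 p s has_derivative (\<lambda>h. \<chi> k. if k = 1 then h $ k else s * h $ k)) (at q)"
    unfolding scale23_def
  proof (rule has_derivative_vec_lambda)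
    fix k :: 3
    show "((\<lambda>q. if k = 1 then q $ k else p $ k + s * (q $ k - p $ k)) has_derivative
      (\<lambda>h. if k = 1 then h $ k else s * h $ k)) (at q)"
      by (cases "k = 1") (auto intro!: derivative_eq_intros bounded_linear_imp_has_derivative bounded_linear_vec_nth)
  qed
  from has_derivative_compose[OF this hol_onD[OF assms]] show ?thesis
    by (rule has_derivative_eq_rhs) (auto intro!: sum.cong)
qed

lemma has_vector_derivative_scale23:
  assumes "hol_on V f" "scale23 p s q \<in> V"
  shows "((\<lambda>s. f (scale23 p s q)) has_vector_derivative
    (q $ 2 - p $ 2) * pdiff 2 f (scale23 p s q) + (q $ 3 - p $ 3) * pdiff 3 f (scale23 p s q)) (at s within S)"
proof -
  have "((\<lambda>s. scale23 p s q) has_derivative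
      (\<lambda>h. \<chi> k. if k = 1 then 0 else of_real h * (q $ k - p $ k))) (at s within S)"
    unfolding scale23_def
  proof (rule has_derivative_vec_lambda)
    fix k :: 3
    show "((\<lambda>s. if k = 1 then q $ k else p $ k + of_real s * (q $ k - p $ k)) has_derivative
      (\<lambda>h. if k = 1 then 0 else of_real h * (q $ k - p $ k))) (at s within S)"
      by (cases "k = 1") (auto intro!: derivative_eq_intros)
  qed
  from has_derivative_compose[OF this hol_onD[OF assms]] show ?thesis
    unfolding has_vector_derivative_def
    by (rule has_derivative_eq_rhs) (auto simp: sum_3 scaleR_conv_of_real algebra_simps)
qed

text \<open>The velocity of \<open>scale23 p s q\<close> has no first component, so \<open>f\<close>
  is constant along the segment. Its endpoint at \<open>s = 0\<close> retains only the first
  coordinate of \<open>q\<close>.\<close>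

lemma depends_on_first_coordinate:
  assumes hol: "hol_on (ball p e) f" and q: "q \<in> ball p e"
    and zero: "\<And>q. q \<in> ball p e \<Longrightarrow> pdiff 2 f q = 0" "\<And>q. q \<in> ball p e \<Longrightarrow> pdiff 3 f q = 0"
  shows "f q = f (scale23 p 0 q)"
proof -
  have "((\<lambda>s. f (scale23 p s q)) has_vector_derivative 0) (at s within {0..1})" if "s \<in> {0..1}" for s
    using has_vector_derivative_scale23[OF hol scale23_in_ball[OF q that]]
    by (simp add: zero[OF scale23_in_ball[OF q that]])
  then obtain c where "\<And>s. s \<in> {0..1} \<Longrightarrow> f (scale23 p s q) = c"
    using has_vector_derivative_zero_constant[of "{0..1}"] by (metis convex_real_interval(5))
  from this[of 0] this[of 1] show ?thesis by (simp add: scale23_1)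
qed

text \<open>Poincare lemma in the variables \<open>z\<close> and \<open>ybar\<close>, with
  \<open>y\<close> as a parameter. Differentiating the line integral in all three variables at once
  also gives holomorphy in \<open>y\<close>.\<close>

lemma poincare_23:
  fixes p :: "complex ^ 3"
  assumes a: "hol_on (ball p e) a" and b: "hol_on (ball p e) b"
    and closed: "\<And>q. q \<in> ball p e \<Longrightarrow> pdiff 3 a q = pdiff 2 b q"
  shows "\<exists>g. hol_on (ball p e) g \<and> (\<forall>q\<in>ball p e. pdiff 2 g q = a q \<and> pdiff 3 g q = b q)"
proof -
  let ?V = "ball p e"
  \<comment> \<open>The line integral of \<open>a dz + b dybar\<close> along the segment ending at \<open>q\<close>.\<close>
  define F where "F q s = (q $ 2 - p $ 2) * a (scale23 p s q) + (q $ 3 - p $ 3) * b (scale23 p s q)"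
    for q s
  \<comment> \<open>The gradient of \<open>F\<close> in \<open>q\<close> by the product rule: first
    the derivatives of the factors \<open>q $ 2 - p $ 2\<close> and \<open>q $ 3 - p $ 3\<close>,
    then those of \<open>a\<close> and \<open>b\<close>, weighted by \<open>s\<close> except in the
    first direction, which \<open>scale23\<close> leaves unscaled.\<close>
  define c :: "3 \<Rightarrow> complex ^ 3 \<Rightarrow> real \<Rightarrow> complex" where "c k q s = (if k = 2 then a (scale23 p s q) else if k = 3 then b (scale23 p s q) else 0)
      + (if k = 1 then 1 else of_real s) * ((q $ 2 - p $ 2) * pdiff k a (scale23 p s q)
        + (q $ 3 - p $ 3) * pdiff k b (scale23 p s q))" for k q s
  define g where "g q = integral {0..1} (F q)" for q
  have cont: "continuous_on (?V \<times> {0..1}) (\<lambda>x. f (scale23 p (snd x) (fst x)))"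
    if "continuous_on ?V f" for f :: "_ \<Rightarrow> complex"
    by (rule continuous_on_compose2[OF that continuous_on_scale23]) (use scale23_in_ball in force)
  have cont1: "continuous_on {0..1} (\<lambda>s. f (scale23 p s q))"
    if "continuous_on ?V f" "q \<in> ?V" for f :: "_ \<Rightarrow> complex" and q
    using continuous_on_compose2[OF cont[OF that(1)], of "{0..1}" "Pair q"] that(2)
    by (force intro: continuous_on_Pair continuous_on_const continuous_on_id)
  have contc: "continuous_on (?V \<times> {0..1}) (\<lambda>(q, s). c k q s)" for k
    unfolding c_def split_beta
    by (cases "k = 1"; cases "k = 2"; cases "k = 3")
       (auto intro!: continuous_intros cont hol_on_imp_continuous_on[OF a] hol_on_imp_continuous_on[OF b]
        continuous_on_pdiff[OF open_ball a] continuous_on_pdiff[OF open_ball b])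
  have contF: "continuous_on {0..1} (F q)" if "q \<in> ?V" for q
    unfolding F_def by (intro continuous_intros cont1 hol_on_imp_continuous_on a b that)
  have dF: "((\<lambda>q. F q s) has_derivative (\<lambda>h. \<Sum>k\<in>UNIV. c k q s * h $ k)) (at q)"
    if "q \<in> ?V" "s \<in> {0..1}" for q s
  proof -
    note [derivative_intros] =
      has_derivative_compose_scale23[OF a scale23_in_ball[OF that]]
      has_derivative_compose_scale23[OF b scale23_in_ball[OF that]]
      bounded_linear_imp_has_derivative[OF bounded_linear_vec_nth]
    show ?thesis unfolding F_def c_def
      by (auto intro!: derivative_eq_intros simp: sum_3 algebra_simps)
  qed
  have dg: "(g has_derivative (\<lambda>h. \<Sum>k\<in>UNIV. integral {0..1} (c k q) * h $ k)) (at q)"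
    if "q \<in> ?V" for q
    unfolding g_def
    by (rule integral_has_gradient[OF open_ball convex_ball that dF contc contF])
  \<comment> \<open>The integrand is the \<open>s\<close>-derivative of
    \<open>s * f (scale23 p s q)\<close>, which is 0 at \<open>s = 0\<close> and \<open>f q\<close>
    at \<open>s = 1\<close>.\<close>
  have ftc: "integral {0..1} (\<lambda>s. f (scale23 p s q) + of_real s *
      ((q $ 2 - p $ 2) * pdiff 2 f (scale23 p s q) + (q $ 3 - p $ 3) * pdiff 3 f (scale23 p s q))) = f q"
    if "hol_on ?V f" "q \<in> ?V" for f q
  proof -
    have "((\<lambda>s. of_real s * f (scale23 p s q)) has_vector_derivative f (scale23 p s q) + of_real s *
      ((q $ 2 - p $ 2) * pdiff 2 f (scale23 p s q) + (q $ 3 - p $ 3) * pdiff 3 f (scale23 p s q)))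
      (at s within {0..1})" if s: "s \<in> {0..1}" for s
      by (rule has_vector_derivative_eq_rhs, rule has_vector_derivative_mult,
          rule has_vector_derivative_of_real, rule DERIV_ident,
          rule has_vector_derivative_scale23[OF \<open>hol_on ?V f\<close> scale23_in_ball[OF \<open>q \<in> ?V\<close> s]]) simp
    from integral_unique[OF fundamental_theorem_of_calculus[OF _ this]]
    show ?thesis by (simp add: scale23_1)
  qed
  have "pdiff 2 g q = a q \<and> pdiff 3 g q = b q" if q: "q \<in> ?V" for q
  proof -
    \<comment> \<open>Closedness exchanges \<open>pdiff 2 b\<close> and \<open>pdiff 3 a\<close>,
      which turns \<open>c 2 q\<close> into the integrand of \<open>ftc\<close> for
      \<open>a\<close>; the same exchange treats \<open>c 3 q\<close> and \<open>b\<close>.\<close>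
    have "integral {0..1} (c 2 q) = a q"
      unfolding ftc[OF a q, symmetric]
      by (rule integral_cong) (simp add: c_def closed[OF scale23_in_ball[OF q]])
    moreover have "integral {0..1} (c 3 q) = b q"
      unfolding ftc[OF b q, symmetric]
      by (rule integral_cong) (simp add: c_def closed[OF scale23_in_ball[OF q]])
    ultimately show ?thesis using pdiff_eqI[OF dg[OF q]] by simp
  qed
  moreover have "hol_on ?V g" by (rule hol_onI[OF dg])
  ultimately show ?thesis by blast
qed

subsection \<open>Matrix fields\<close>

lemma holo_on_iff: "holo_on U M \<longleftrightarrow> (\<forall>i j. hol_on U (\<lambda>q. M q $ i $ j))"
  unfolding holo_on_def hol_on_def by blast

lemma partial_entry: "partial k M p $ i $ j = pdiff k (\<lambda>q. M q $ i $ j) p"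
  by (simp add: partial_def pdiff_def)

lemma holo_on_subset: "holo_on U M \<Longrightarrow> V \<subseteq> U \<Longrightarrow> holo_on V M"
  unfolding holo_on_def by blast

lemma holo_on_partial: "open U \<Longrightarrow> holo_on U M \<Longrightarrow> holo_on U (partial k M)"
  by (simp add: holo_on_iff partial_entry hol_on_pdiff)

lemma holo_on_add: "holo_on U M \<Longrightarrow> holo_on U N \<Longrightarrow> holo_on U (\<lambda>q. M q + N q)"
  by (simp add: holo_on_iff hol_on_add)

lemma holo_on_minus: "holo_on U M \<Longrightarrow> holo_on U (\<lambda>q. - M q)"
  by (simp add: holo_on_iff hol_on_minus)

lemma holo_on_diff: "holo_on U M \<Longrightarrow> holo_on U N \<Longrightarrow> holo_on U (\<lambda>q. M q - N q)"
  by (simp add: holo_on_iff hol_on_diff)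

lemma holo_on_matrix_mult: "holo_on U M \<Longrightarrow> holo_on U N \<Longrightarrow> holo_on U (\<lambda>q. M q ** N q)"
  by (simp add: holo_on_iff matrix_matrix_mult_def hol_on_sum hol_on_mult)

lemma holo_on_commutator:
  "holo_on U M \<Longrightarrow> holo_on U N \<Longrightarrow> holo_on U (\<lambda>q. commutator (M q) (N q))"
  by (simp add: commutator_def holo_on_diff holo_on_matrix_mult)

lemma holo_on_cov_y: "open U \<Longrightarrow> holo_on U X \<Longrightarrow> holo_on U M \<Longrightarrow> holo_on U (cov_y X M)"
  by (subst cov_y_def[abs_def]) (simp add: holo_on_add holo_on_commutator holo_on_partial)

lemma holo_on_cov_z: "open U \<Longrightarrow> holo_on U X \<Longrightarrow> holo_on U M \<Longrightarrow> holo_on U (cov_z X M)"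
  by (subst cov_z_def[abs_def]) (simp add: holo_on_diff holo_on_commutator holo_on_partial)

lemma partial_commute:
  assumes "open U" "holo_on U M" "p \<in> U"
  shows "partial j (partial k M) p = partial k (partial j M) p"
  using assms by (simp add: vec_eq_iff partial_entry holo_on_iff pdiff_commute)

lemma partial_cong:
  assumes "open U" "p \<in> U" "holo_on U M" "\<And>q. q \<in> U \<Longrightarrow> M q = N q"
  shows "partial k M p = partial k N p"
  unfolding vec_eq_iff partial_entry
proof (intro allI)
  fix i j
  show "pdiff k (\<lambda>q. M q $ i $ j) p = pdiff k (\<lambda>q. N q $ i $ j) p"
    using assms(3,4) by (intro pdiff_cong[OF assms(1,2)]) (auto simp: holo_on_iff)
qed

lemma
  assumes "holo_on U M" "holo_on U N" "p \<in> U"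
  shows partial_add: "partial k (\<lambda>q. M q + N q) p = partial k M p + partial k N p"
    and partial_diff: "partial k (\<lambda>q. M q - N q) p = partial k M p - partial k N p"
  using assms by (simp_all add: vec_eq_iff partial_entry holo_on_iff pdiff_add[of U] pdiff_diff[of U])

lemma partial_minus:
  assumes "holo_on U M" "p \<in> U"
  shows "partial k (\<lambda>q. - M q) p = - partial k M p"
  using assms by (simp add: vec_eq_iff partial_entry holo_on_iff pdiff_minus[of U])

lemma partial_matrix_mult:
  assumes "holo_on U M" "holo_on U N" "p \<in> U"
  shows "partial k (\<lambda>q. M q ** N q) p = partial k M p ** N p + M p ** partial k N p"
  unfolding vec_eq_iff
proof (intro allI)
  fix i j
  have "partial k (\<lambda>q. M q ** N q) p $ i $ j = pdiff k (\<lambda>q. \<Sum>l\<in>UNIV. M q $ i $ l * N q $ l $ j) p"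
    by (simp add: partial_entry matrix_matrix_mult_def)
  also have "\<dots> = (\<Sum>l\<in>UNIV. pdiff k (\<lambda>q. M q $ i $ l * N q $ l $ j) p)"
    using assms by (intro pdiff_sum[of _ U]) (auto simp: holo_on_iff intro: hol_on_mult)
  also have "\<dots> = (\<Sum>l\<in>UNIV. partial k M p $ i $ l * N p $ l $ j + M p $ i $ l * partial k N p $ l $ j)"
    using assms by (simp add: holo_on_iff partial_entry pdiff_mult[of U])
  finally show "partial k (\<lambda>q. M q ** N q) p $ i $ j = (partial k M p ** N p + M p ** partial k N p) $ i $ j"
    by (simp add: matrix_matrix_mult_def sum.distrib)
qed

lemma partial_commutator:
  assumes "holo_on U M" "holo_on U N" "p \<in> U"
  shows "partial k (\<lambda>q. commutator (M q) (N q)) p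
    = commutator (partial k M p) (N p) + commutator (M p) (partial k N p)"
  unfolding commutator_def
  using assms by (simp add: partial_diff[of U] holo_on_matrix_mult partial_matrix_mult[of U])

section \<open>Algebra of commutators and traces\<close>

lemma commutator_entry:
  "commutator A B $ i $ j = (\<Sum>l\<in>UNIV. A $ i $ l * B $ l $ j - B $ i $ l * A $ l $ j)"
  by (simp add: commutator_def matrix_matrix_mult_def sum_subtractf)

lemma
  shows commutator_add_left: "commutator (A + B) C = commutator A C + commutator B C"
    and commutator_add_right: "commutator A (B + C) = commutator A B + commutator A C"
    and commutator_diff_right: "commutator A (B - C) = commutator A B - commutator A C"
    and commutator_minus_right: "commutator A (- B) = - commutator A B"
  by (simp_all add: vec_eq_iff commutator_entry algebra_simps flip: sum.distrib sum_subtractf sum_negf)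

lemma commutator_0_left: "commutator 0 A = 0"
  by (simp add: vec_eq_iff commutator_entry)

text \<open>Jacobi identity, oriented so that rewriting moves all nesting into the right
  argument.\<close>

lemma commutator_jacobi:
  "commutator (commutator A B) C = commutator A (commutator B C) - commutator B (commutator A C)"
proof -
  have mult_diff: "M ** (N - K) = M ** N - M ** K" "(N - K) ** M = N ** M - K ** M"
    for M N K :: "complex ^ 'a ^ 'a"
    by (simp_all add: vec_eq_iff matrix_matrix_mult_def algebra_simps sum_subtractf)
  show ?thesis
    by (simp add: commutator_def mult_diff matrix_mul_assoc)
qed

lemma trace_commutator: "trace (commutator A B) = 0"
  by (simp add: commutator_def trace_sub trace_mul_sym[of A B])

lemma hol_on_trace: "holo_on U M \<Longrightarrow> hol_on U (\<lambda>q. trace (M q))"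
  by (simp add: trace_def holo_on_iff hol_on_sum)

lemma pdiff_trace: "holo_on U M \<Longrightarrow> p \<in> U \<Longrightarrow> pdiff k (\<lambda>q. trace (M q)) p = trace (partial k M p)"
  by (simp add: trace_def holo_on_iff partial_entry pdiff_sum[of _ U])

subsection \<open>The recursion operator\<close>

text \<open>For a relation, linearity means that its graph is a linear subspace. With
  \<open>X\<close> fixed, both defining equations are linear in the pair of fields.\<close>

lemma recursion_image_lincomb:
  assumes "recursion_image U X \<Phi> \<Phi>'" "recursion_image U X \<Psi> \<Psi>'"
  shows "recursion_image U X (lincomb a \<Phi> b \<Psi>) (lincomb a \<Phi>' b \<Psi>')"
proof -
  have hol: "holo_on U (lincomb a M b N)" if "holo_on U M" "holo_on U N" for M N
    using that by (simp add: holo_on_iff lincomb_def hol_on_add hol_on_cmult)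
  have part: "partial k (lincomb a M b N) p $ i $ j = a * partial k M p $ i $ j + b * partial k N p $ i $ j"
    if "holo_on U M" "holo_on U N" "p \<in> U" for M N k p i j
    using that by (simp add: partial_entry lincomb_def holo_on_iff hol_on_cmult
        pdiff_add[of U] pdiff_cmult[of U])
  have comm: "commutator A (lincomb a M b N p) $ i $ j
      = a * commutator A (M p) $ i $ j + b * commutator A (N p) $ i $ j" for A M N p i j
    by (simp add: commutator_entry lincomb_def sum_distrib_left algebra_simps flip: sum.distrib)
  show ?thesis
    using assms unfolding recursion_image_def
    by (simp add: hol vec_eq_iff part cov_y_def cov_z_def comm) (simp add: algebra_simps)
qed

text \<open>The claim is local because a closed form on a general \<open>U\<close> can have periods;
  on a ball \<open>poincare_23\<close> applies to each matrix entry.\<close>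

lemma recursion_image_exists_locally:
  assumes "open U" "holo_on U X" "symmetry_characteristic U X \<Phi>" "p \<in> U"
  shows "\<exists>V \<Phi>'. open V \<and> p \<in> V \<and> V \<subseteq> U \<and> recursion_image V X \<Phi> \<Phi>'"
proof -
  obtain e where e: "e > 0" "ball p e \<subseteq> U"
    by (rule openE[OF assms(1,4)])
  let ?V = "ball p e"
  have hol: "holo_on U \<Phi>"
    and sym: "\<And>q. q \<in> U \<Longrightarrow> D_ybar (cov_y X \<Phi>) q + D_z (cov_z X \<Phi>) q = 0"
    using assms(3) by (auto simp: symmetry_characteristic_def)
  have y: "holo_on ?V (cov_y X \<Phi>)" and z: "holo_on ?V (\<lambda>q. - cov_z X \<Phi> q)"
    using holo_on_cov_y[OF assms(1,2) hol] holo_on_cov_z[OF assms(1,2) hol] e(2)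
    by (auto intro: holo_on_subset holo_on_minus)
  have "pdiff 3 (\<lambda>q. cov_y X \<Phi> q $ i $ j) q = pdiff 2 (\<lambda>q. (- cov_z X \<Phi> q) $ i $ j) q"
    if "q \<in> ?V" for q i j
  proof -
    have q: "q \<in> U" using that e(2) by blast
    \<comment> \<open>The symmetry condition, read as closedness of the form
      \<open>cov_y X \<Phi> dz - cov_z X \<Phi> dybar\<close>.\<close>
    have "D_ybar (cov_y X \<Phi>) q = D_z (\<lambda>q. - cov_z X \<Phi> q) q"
      using sym[OF q] by (simp add: partial_minus[OF holo_on_cov_z[OF assms(1,2) hol] q]
          eq_neg_iff_add_eq_0)
    then show ?thesis by (simp add: vec_eq_iff partial_entry)
  qed
  then have "\<forall>i j. \<exists>g. hol_on ?V g \<and>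
      (\<forall>q\<in>?V. pdiff 2 g q = cov_y X \<Phi> q $ i $ j \<and> pdiff 3 g q = (- cov_z X \<Phi> q) $ i $ j)"
    using y z by (intro allI poincare_23) (auto simp: holo_on_iff)
  then obtain g where g: "\<And>i j. hol_on ?V (g i j)"
      "\<And>i j q. q \<in> ?V \<Longrightarrow> pdiff 2 (g i j) q = cov_y X \<Phi> q $ i $ j"
      "\<And>i j q. q \<in> ?V \<Longrightarrow> pdiff 3 (g i j) q = (- cov_z X \<Phi> q) $ i $ j"
    by metis
  have "recursion_image ?V X \<Phi> (\<lambda>q. \<chi> i j. g i j q)"
    unfolding recursion_image_def using holo_on_subset[OF hol e(2)] g
    by (simp add: holo_on_iff vec_eq_iff partial_entry)
  with e show ?thesis
    by (intro exI[of _ ?V] exI[of _ "\<lambda>q. \<chi> i j. g i j q"]) simp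
qed

text \<open>The undifferentiated \<open>\<Phi>'\<close> occurs only in commutators with mixed
  derivatives of \<open>X\<close>, which cancel. The rest is \<open>cov_z\<close> after
  \<open>cov_y\<close> minus \<open>cov_y\<close> after \<open>cov_z\<close>, applied to
  \<open>\<Phi>\<close>.\<close>

lemma symmetry_characteristic_recursion_image:
  assumes U: "open U" and X: "psdym3_solution U X" and R: "recursion_image U X \<Phi> \<Phi>'"
  shows "symmetry_characteristic U X \<Phi>'"
  unfolding symmetry_characteristic_def
proof (intro conjI ballI)
  have hX: "holo_on U X" and G: "\<And>p. p \<in> U \<Longrightarrow> G X p = 0"
    using X by (auto simp: psdym3_solution_def)
  have h: "holo_on U \<Phi>" and h': "holo_on U \<Phi>'"
    and Dz: "\<And>p. p \<in> U \<Longrightarrow> D_z \<Phi>' p = cov_y X \<Phi> p"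
    and Dyb: "\<And>p. p \<in> U \<Longrightarrow> D_ybar \<Phi>' p = - cov_z X \<Phi> p"
    using R by (auto simp: recursion_image_def)
  show "holo_on U \<Phi>'" by (rule h')
  fix p assume p: "p \<in> U"
  note hol = holo_on_partial[OF U] holo_on_commutator hX h h'
  \<comment> \<open>The defining equations say nothing about \<open>D_y \<Phi>'\<close>; exchanging
    the derivatives brings in \<open>D_ybar \<Phi>'\<close>, which they determine.\<close>
  have "D_ybar (D_y \<Phi>') p = D_y (D_ybar \<Phi>') p"
    by (rule partial_commute[OF U h' p])
  also have "\<dots> = D_y (\<lambda>q. - cov_z X \<Phi> q) p"
    by (rule partial_cong[OF U p]) (simp_all add: hol Dyb)
  also have "\<dots> = - D_y (D_z \<Phi>) p + commutator (D_y (D_ybar X) p) (\<Phi> p)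
      + commutator (D_ybar X p) (D_y \<Phi> p)"
    using p by (simp add: partial_minus[of U] holo_on_cov_z[OF U] hol)
      (simp add: cov_z_def[abs_def] partial_diff[of U] partial_commutator[of U] hol)
  finally have 1: "D_ybar (D_y \<Phi>') p = \<dots>" .
  have "D_z (D_z \<Phi>') p = D_z (cov_y X \<Phi>) p"
    by (rule partial_cong[OF U p]) (simp_all add: hol Dz)
  also have "\<dots> = D_z (D_y \<Phi>) p + commutator (D_z (D_z X) p) (\<Phi> p)
      + commutator (D_z X p) (D_z \<Phi> p)"
    using p by (simp add: cov_y_def[abs_def] partial_add[of U] partial_commutator[of U] hol)
  finally have 2: "D_z (D_z \<Phi>') p = \<dots>" .
  have 3: "D_ybar (cov_y X \<Phi>') p = D_ybar (D_y \<Phi>') p + commutator (D_ybar (D_z X) p) (\<Phi>' p)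
      + commutator (D_z X p) (D_ybar \<Phi>' p)"
    using p by (simp add: cov_y_def[abs_def] partial_add[of U] partial_commutator[of U] hol)
  have 4: "D_z (cov_z X \<Phi>') p = D_z (D_z \<Phi>') p - commutator (D_z (D_ybar X) p) (\<Phi>' p)
      - commutator (D_ybar X p) (D_z \<Phi>' p)"
    using p by (simp add: cov_z_def[abs_def] partial_diff[of U] partial_commutator[of U] hol)
  \<comment> \<open>The second-order terms of \<open>G\<close> come from facts 1 and 2; its
    commutator term arises from the nested commutators by the Jacobi identity.\<close>
  have "D_ybar (cov_y X \<Phi>') p + D_z (cov_z X \<Phi>') p = commutator (G X p) (\<Phi> p)"
    unfolding 3 4 1 2 Dz[OF p] Dyb[OF p] G_def cov_y_def cov_z_def
      partial_commute[OF U hX p, of 3 2] partial_commute[OF U hX p, of 3 1]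
      partial_commute[OF U h p, of 2 1]
    by (simp add: commutator_add_left commutator_add_right commutator_diff_right
        commutator_minus_right commutator_jacobi)
  then show "D_ybar (cov_y X \<Phi>') p + D_z (cov_z X \<Phi>') p = 0"
    by (simp add: G[OF p] commutator_0_left)
qed

text \<open>The defining equations fix \<open>\<Phi>'\<close> only up to a function of
  \<open>y\<close>, which may itself have a trace, so tracelessness is a matter of choosing the
  representative.\<close>

lemma recursion_image_traceless:
  fixes X :: "'n::finite field"
  assumes U: "open U" and R: "recursion_image U X \<Phi> \<Phi>'" and tr: "traceless_on U \<Phi>"
  shows "\<exists>C. function_of_y_alone U C \<and> recursion_image U X \<Phi> (\<lambda>p. \<Phi>' p - C p) \<and>
    traceless_on U (\<lambda>p. \<Phi>' p - C p)"
proof -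
  have h: "holo_on U \<Phi>" and h': "holo_on U \<Phi>'"
    and Dz: "\<And>p. p \<in> U \<Longrightarrow> D_z \<Phi>' p = cov_y X \<Phi> p"
    and Dyb: "\<And>p. p \<in> U \<Longrightarrow> D_ybar \<Phi>' p = - cov_z X \<Phi> p"
    using R by (auto simp: recursion_image_def)
  define c where "c p = inverse (of_nat CARD('n)) * trace (\<Phi>' p)" for p
  define C :: "'n field" where "C p = mat (c p)" for p
  have trD: "trace (partial k \<Phi> p) = 0" if "p \<in> U" for k p
  proof -
    have "pdiff k (\<lambda>q. trace (\<Phi> q)) p = pdiff k (\<lambda>q. 0) p"
      using tr by (intro pdiff_cong[OF U that hol_on_trace[OF h]]) (simp add: traceless_on_def)
    then show ?thesis by (simp add: pdiff_trace[OF h that] pdiff_const)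
  qed
  have hc: "hol_on U c"
    unfolding c_def by (intro hol_on_cmult hol_on_trace h')
  \<comment> \<open>By the defining equations these are, up to constant factors, traces of
    derivatives of \<open>\<Phi>\<close> and of commutators.\<close>
  have dc: "pdiff 2 c p = 0" "pdiff 3 c p = 0" if "p \<in> U" for p
    using that trD[OF that]
    by (simp_all add: c_def[abs_def] pdiff_cmult[of U] hol_on_trace[OF h'] pdiff_trace[OF h'] Dz Dyb
        cov_y_def cov_z_def trace_add trace_sub trace_commutator)
  have C_entry: "(\<lambda>q. C q $ i $ j) = (if i = j then c else (\<lambda>q. 0))" for i j
    by (simp add: C_def mat_def fun_eq_iff)
  have hC: "holo_on U C"
    by (simp add: holo_on_iff C_entry hc hol_on_const)
  have dC: "D_z C p = 0" "D_ybar C p = 0" if "p \<in> U" for p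
    using that by (simp_all add: vec_eq_iff partial_entry C_entry dc pdiff_const)
  have "function_of_y_alone U C"
    unfolding function_of_y_alone_def
  proof
    fix p assume "p \<in> U"
    then obtain e where e: "e > 0" "ball p e \<subseteq> U"
      by (rule openE[OF U])
    \<comment> \<open>Freezing the second and third coordinates at those of the centre
      \<open>p\<close> exhibits \<open>C\<close> as a function of \<open>q $ 1\<close>
      alone.\<close>
    have "C q = mat (c (\<chi> k. if k = 1 then q $ 1 else p $ k))" if "q \<in> ball p e" for q
    proof -
      have "scale23 p 0 q = (\<chi> k. if k = 1 then q $ 1 else p $ k)"
        by (simp add: scale23_def vec_eq_iff)
      then show ?thesis
        unfolding C_def using e(2) dc
        by (subst depends_on_first_coordinate[OF hol_on_subset[OF hc e(2)] that]) auto
    qed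
    with e show "\<exists>V d. open V \<and> p \<in> V \<and> V \<subseteq> U \<and> (\<forall>q\<in>V. C q = d (q $ 1))"
      by (intro exI[of _ "ball p e"] exI[of _ "\<lambda>y. mat (c (\<chi> k. if k = 1 then y else p $ k))"]) simp
  qed
  moreover have "recursion_image U X \<Phi> (\<lambda>p. \<Phi>' p - C p)"
    unfolding recursion_image_def
    using h h' hC by (simp add: holo_on_diff partial_diff[of U] dC Dz Dyb)
  moreover have "trace (C p) = trace (\<Phi>' p)" for p
    by (simp add: C_def c_def trace_def mat_def)
  then have "traceless_on U (\<lambda>p. \<Phi>' p - C p)"
    by (simp add: traceless_on_def trace_sub)
  ultimately show ?thesis by blast
qed

text \<open>The hypotheses on \<open>X\<close> and \<open>\<Phi>\<close> pass to smaller open sets,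
  so on the sets \<open>V\<close> of the existence clause the remaining claims concern images that
  do exist.\<close>

theorem mainTheorem5:
  fixes U :: "(complex ^ 3) set" and X :: "'n::finite field"
  assumes "open U"
    and "psdym3_solution U X"
    and "traceless_on U X"
  shows "(\<forall>a b \<Phi> \<Phi>' \<Psi> \<Psi>'. recursion_image U X \<Phi> \<Phi>' \<longrightarrow> recursion_image U X \<Psi> \<Psi>' \<longrightarrow>
            recursion_image U X (lincomb a \<Phi> b \<Psi>) (lincomb a \<Phi>' b \<Psi>')) \<and>
         (\<forall>\<Phi>. symmetry_characteristic U X \<Phi> \<longrightarrow>
            (\<forall>p\<in>U. \<exists>V \<Phi>'. open V \<and> p \<in> V \<and> V \<subseteq> U \<and> recursion_image V X \<Phi> \<Phi>') \<and>
            (\<forall>\<Phi>'. recursion_image U X \<Phi> \<Phi>' \<longrightarrow> symmetry_characteristic U X \<Phi>') \<and>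
            (traceless_on U \<Phi> \<longrightarrow>
               (\<forall>\<Phi>'. recursion_image U X \<Phi> \<Phi>' \<longrightarrow>
                  (\<exists>C. function_of_y_alone U C \<and>
                       recursion_image U X \<Phi> (\<lambda>p. \<Phi>' p - C p) \<and>
                       traceless_on U (\<lambda>p. \<Phi>' p - C p)))))"
proof (intro conjI allI impI ballI)
  have hX: "holo_on U X" using assms(2) by (simp add: psdym3_solution_def)
  fix \<Phi>
  assume sym: "symmetry_characteristic U X \<Phi>"
  show "\<exists>V \<Phi>'. open V \<and> p \<in> V \<and> V \<subseteq> U \<and> recursion_image V X \<Phi> \<Phi>'" if "p \<in> U" for p
    by (rule recursion_image_exists_locally[OF assms(1) hX sym that])
qed (rule recursion_image_lincomb symmetry_characteristic_recursion_image[OF assms(1,2)]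
    recursion_image_traceless[OF assms(1)]; assumption)+

end
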